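(* Let $\alpha>0$ be known, $n_0>0$ and $u_0>0$. Let $X=(x_1,\dots,x_n)$, $n\ge1$, be positive observations that are i.i.d. given an upper bound $u>0$, each with the Power density $p(x_i\mid u)=\mathrm{Power}(x_i\mid u,\alpha)$. Suppose $u$ has prior distribution $\mathrm{Pareto}(\alpha n_0,u_0)$. Then the posterior distribution of $u$ given $X$ is $$p(u\mid X)=\mathrm{Pareto}\big(u\mid \alpha(n+n_0),\ u_n\big),\qquad u_n=\max\Big(u_0,\ \max_{1\le i\le n}x_i\Big).$$ In particular the Pareto family is a conjugate prior family for the upper bound $u$ of the Power distribution with known $\alpha$.
   Context: For $a,b>0$, $\mathrm{Power}(x\mid a,b)=\frac{b x^{b-1}}{a^{b}}$ for $0<x<a$ and $0$ otherwise. For $a,b>0$, $\mathrm{Pareto}(y\mid a,b)=\frac{a b^{a}}{y^{a+1}}$ for $y>b$ and $0$ otherwise. The posterior density is $p(u\mid X)=p(X\mid u)p(u)\big/\int p(X\mid u)p(u)\,du$ with $p(X\mid u)=\prod_i p(x_i\mid u)$; densities are identified when they agree almost everywhere. A prior is conjugate for a sampling distribution if the posterior belongs to the same parametric family as the prior. *)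

theory Defs
  imports "HOL-Analysis.Analysis"
begin

text \<open>For \<open>a \<le> 0\<close> the support \<open>0 < x < a\<close> is empty, so the density is identically 0 there; the
  extension to nonpositive upper bounds contributes nothing to the integral over \<open>u\<close> below.\<close>

definition power_density :: "real \<Rightarrow> real \<Rightarrow> real \<Rightarrow> real" where
  "power_density a b x = (if 0 < x \<and> x < a then b * x powr (b - 1) / a powr b else 0)"

definition pareto_density :: "real \<Rightarrow> real \<Rightarrow> real \<Rightarrow> real" where
  "pareto_density a b y = (if b < y then a * b powr a / y powr (a + 1) else 0)"

definition pareto_family :: "(real \<Rightarrow> real) set" where
  "pareto_family = {pareto_density a b | a b. 0 < a \<and> 0 < b}"

text \<open>A sampling model is a function \<open>f\<close> with \<open>f u\<close> the density of one observation given the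
  parameter \<open>u\<close>. Observations \<open>x 1, \<dots>, x n\<close> that are i.i.d. given \<open>u\<close> have joint density:\<close>

definition likelihood :: "(real \<Rightarrow> 'x \<Rightarrow> real) \<Rightarrow> nat \<Rightarrow> (nat \<Rightarrow> 'x) \<Rightarrow> real \<Rightarrow> real" where
  "likelihood f n x u = (\<Prod>i = 1..n. f u (x i))"

text \<open>If the integral in the denominator diverges or vanishes, the quotient is identically 0 and
  hence not almost everywhere equal to any probability density.\<close>

definition posterior_density ::
  "(real \<Rightarrow> 'x \<Rightarrow> real) \<Rightarrow> (real \<Rightarrow> real) \<Rightarrow> nat \<Rightarrow> (nat \<Rightarrow> 'x) \<Rightarrow> real \<Rightarrow> real" where
  "posterior_density f p n x u =
     likelihood f n x u * p u / (\<integral>v. likelihood f n x v * p v \<partial>lborel)"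

text \<open>\<open>S\<close> is the set of admissible observations, \<open>F\<close> a family of prior densities.\<close>

definition conjugate_prior_family ::
  "(real \<Rightarrow> 'x \<Rightarrow> real) \<Rightarrow> 'x set \<Rightarrow> (real \<Rightarrow> real) set \<Rightarrow> bool" where
  "conjugate_prior_family f S F \<longleftrightarrow>
     (\<forall>p\<in>F. \<forall>n\<ge>1. \<forall>x. (\<forall>i\<in>{1..n}. x i \<in> S) \<longrightarrow>
        (\<exists>q\<in>F. AE u in lborel. posterior_density f p n x u = q u))"

end

theory Submission
  imports Defs
begin

text \<open>For \<open>u > max u\<^sub>0 (max x\<^sub>i)\<close> each factor of the likelihood contributes \<open>u powr (- \<alpha>)\<close>, and for other
  \<open>u\<close> likelihood times prior vanishes. So likelihood times prior is a positive multiple of the claimed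
  Pareto density, and this multiple cancels because Pareto densities integrate to 1.\<close>

text \<open>For \<open>y \<ge> b\<close> the function \<open>F y\<close> is
  \<open>- (b / y) powr a\<close>, an antiderivative of the density that rises from -1 at
  \<open>b\<close> to 0 at infinity.\<close>

lemma integral_pareto_density:
  assumes "0 < a" "0 < b"
  shows "(\<integral>y. pareto_density a b y \<partial>lborel) = 1"
proof -
  define f where "f = (\<lambda>y. a * b powr a / y powr (a + 1))"
  define F where "F = (\<lambda>y. - (b powr a * y powr (- a)))"
  have [measurable]: "f \<in> borel_measurable borel"
    unfolding f_def by measurable
  have "((\<lambda>y::real. - (b powr a * y powr (- a))) \<longlongrightarrow> - (b powr a * 0)) at_top"
    using assms by (intro tendsto_intros tendsto_neg_powr filterlim_ident) auto
  hence lim: "(F \<longlongrightarrow> 0) at_top"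
    by (simp add: F_def)
  have deriv: "DERIV F y :> f y" if "b \<le> y" for y
  proof -
    have "0 < y" using assms that by simp
    have "DERIV F y :> - (b powr a * (- a * y powr (- a - 1)))"
      unfolding F_def using \<open>0 < y\<close> by (auto intro!: derivative_eq_intros)
    moreover have "y powr (- a - 1) = 1 / y powr (a + 1)"
      using powr_minus_divide[of y "a + 1"] by simp
    ultimately show ?thesis
      by (simp add: f_def mult_ac)
  qed
  \<comment> \<open>This covers \<open>y \<le> 0\<close> as well, because \<open>powr\<close> never
    takes negative values and division by 0 gives 0.\<close>
  have nonneg: "0 \<le> f y" for y
    using assms by (simp add: f_def)
  have "(\<integral>\<^sup>+y. ennreal (f y) * indicator {b..} y \<partial>lborel) = ennreal (0 - F b)"
    by (rule nn_integral_FTC_atLeast[OF _ deriv nonneg lim]) auto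
  also have "F b = -1"
    using assms by (simp add: F_def flip: powr_add)
  finally have "(\<integral>\<^sup>+y. ennreal (f y * indicator {b..} y) \<partial>lborel) = ennreal 1"
    by (simp add: ennreal_mult' ennreal_indicator nonneg)
  hence "has_bochner_integral lborel (\<lambda>y. f y * indicator {b..} y) 1"
    by (intro has_bochner_integral_nn_integral) (auto simp: nonneg)
  hence "(\<integral>y. f y * indicator {b..} y \<partial>lborel) = 1"
    by (rule has_bochner_integral_integral_eq)
  \<comment> \<open>The density has the open support \<open>b < y\<close>, while the fundamental
    theorem gives the integral over the closed half-line. The two integrands differ only at the null
    point \<open>b\<close>.\<close>
  moreover have "(\<integral>y. pareto_density a b y \<partial>lborel) = (\<integral>y. f y * indicator {b..} y \<partial>lborel)"
  proof (rule integral_cong_AE)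
    show "AE y in lborel. pareto_density a b y = f y * indicator {b..} y"
      using AE_lborel_singleton[of b]
      by eventually_elim (auto simp: pareto_density_def f_def indicator_def)
  qed (auto simp: pareto_density_def[abs_def])
  ultimately show ?thesis by simp
qed

text \<open>The denominator equals \<open>C\<close> times the integral of \<open>q\<close>, hence
  \<open>C\<close>, and cancels against the numerator. Thus no normalising constant of a posterior
  has to be computed directly.\<close>

lemma posterior_density_eqI:
  assumes "\<And>u. likelihood f n x u * p u = C * q u"
    and "C \<noteq> 0" "(\<integral>u. q u \<partial>lborel) = 1"
  shows "posterior_density f p n x u = q u"
  using assms by (simp add: posterior_density_def)

text \<open>Since \<open>n \<ge> 1\<close>, the maximum is attained by some observation. That
  observation lies outside the support \<open>0 < x < u\<close>, so its factor is zero.\<close>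

lemma likelihood_power_density_zero:
  assumes "1 \<le> n" "u \<le> Max (x ` {1..n})"
  shows "likelihood (\<lambda>u. power_density u \<alpha>) n x u = 0"
proof -
  have "Max (x ` {1..n}) \<in> x ` {1..n}"
    using assms by (intro Max_in) auto
  then obtain i where "i \<in> {1..n}" "u \<le> x i"
    using assms(2) by (metis imageE)
  thus ?thesis
    by (auto simp: likelihood_def power_density_def intro!: prod_zero bexI[of _ i])
qed

lemma likelihood_power_density:
  assumes "\<And>i. i \<in> {1..n} \<Longrightarrow> 0 < x i \<and> x i < u" "0 < u"
  shows "likelihood (\<lambda>u. power_density u \<alpha>) n x u
    = (\<Prod>i = 1..n. \<alpha> * x i powr (\<alpha> - 1)) / u powr (\<alpha> * real n)"
proof -
  have "likelihood (\<lambda>u. power_density u \<alpha>) n x u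
      = (\<Prod>i = 1..n. \<alpha> * x i powr (\<alpha> - 1) / u powr \<alpha>)"
    unfolding likelihood_def using assms by (intro prod.cong) (auto simp: power_density_def)
  also have "\<dots> = (\<Prod>i = 1..n. \<alpha> * x i powr (\<alpha> - 1)) / (u powr \<alpha>) ^ n"
    by (simp add: prod_dividef)
  also have "(u powr \<alpha>) ^ n = u powr (\<alpha> * real n)"
    using assms(2) by (simp add: powr_powr flip: powr_realpow)
  finally show ?thesis .
qed

text \<open>Equality holds at every \<open>u\<close>, not just almost everywhere: all supports are
  bounded by strict inequalities, so both sides vanish at the endpoint too.\<close>

lemma posterior_power_pareto:
  assumes "0 < \<alpha>" "0 < n0" "0 < u0" "1 \<le> n" "\<And>i. i \<in> {1..n} \<Longrightarrow> 0 < x i"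
  shows "posterior_density (\<lambda>u. power_density u \<alpha>) (pareto_density (\<alpha> * n0) u0) n x u
    = pareto_density (\<alpha> * (real n + n0)) (max u0 (Max (x ` {1..n}))) u"
proof -
  define m where "m = max u0 (Max (x ` {1..n}))"
  \<comment> \<open>\<open>K\<close> is the part of the likelihood free of \<open>u\<close>;
    \<open>A\<close> and \<open>B\<close> are the numerators of the prior and of the claimed
    posterior. On the common support the required factor is therefore
    \<open>K * A / B\<close>.\<close>
  define K where "K = (\<Prod>i = 1..n. \<alpha> * x i powr (\<alpha> - 1))"
  define A where "A = \<alpha> * n0 * u0 powr (\<alpha> * n0)"
  define B where "B = \<alpha> * (real n + n0) * m powr (\<alpha> * (real n + n0))"
  have "0 < m" using assms by (simp add: m_def)
  have "\<alpha> * x i powr (\<alpha> - 1) > 0" if "i \<in> {1..n}" for i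
    using assms(1) assms(5)[OF that] by simp
  hence "0 < K" unfolding K_def by (intro prod_pos) auto
  moreover have "0 < A" "0 < B"
    using assms \<open>0 < m\<close> by (auto simp: A_def B_def)
  ultimately have "K * A / B \<noteq> 0" by simp
  have "likelihood (\<lambda>u. power_density u \<alpha>) n x v * pareto_density (\<alpha> * n0) u0 v
      = K * A / B * pareto_density (\<alpha> * (real n + n0)) m v" for v
  proof (cases "m < v")
    case True
    hence "0 < v" "u0 < v" using \<open>0 < m\<close> by (auto simp: m_def)
    have "x i < v" if "i \<in> {1..n}" for i
    proof -
      have "x i \<le> Max (x ` {1..n})" using that by (intro Max_ge) auto
      thus ?thesis using True by (simp add: m_def)
    qed
    hence "likelihood (\<lambda>u. power_density u \<alpha>) n x v = K / v powr (\<alpha> * real n)"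
      unfolding K_def using assms \<open>0 < v\<close> by (intro likelihood_power_density) auto
    moreover have "pareto_density (\<alpha> * n0) u0 v = A / v powr (\<alpha> * n0 + 1)"
      using \<open>u0 < v\<close> by (simp add: pareto_density_def A_def)
    moreover have "pareto_density (\<alpha> * (real n + n0)) m v = B / v powr (\<alpha> * (real n + n0) + 1)"
      using True by (simp add: pareto_density_def B_def)
    \<comment> \<open>The exponents of likelihood and prior add up to that of the claimed posterior;
      this is where the shape \<open>\<alpha> * (n + n0)\<close> comes from.\<close>
    moreover have "v powr (\<alpha> * (real n + n0) + 1) = v powr (\<alpha> * real n) * v powr (\<alpha> * n0 + 1)"
      by (simp add: algebra_simps flip: powr_add)
    ultimately show ?thesis
      using \<open>0 < B\<close> by simp
  next
    case False
    \<comment> \<open>In the first case the prior vanishes, in the second the likelihood.\<close>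
    hence "v \<le> u0 \<or> v \<le> Max (x ` {1..n})" by (auto simp: m_def)
    thus ?thesis
      using False assms(4) likelihood_power_density_zero[of n v x \<alpha>]
      by (auto simp: pareto_density_def)
  qed
  moreover have "(\<integral>v. pareto_density (\<alpha> * (real n + n0)) m v \<partial>lborel) = 1"
    using assms \<open>0 < m\<close> by (intro integral_pareto_density) auto
  ultimately show ?thesis
    using \<open>K * A / B \<noteq> 0\<close> unfolding m_def by (intro posterior_density_eqI)
qed

theorem mainTheorem3:
  fixes \<alpha> :: real
  assumes "0 < \<alpha>"
  shows "(\<forall>n0 u0 :: real. \<forall>n :: nat. \<forall>x :: nat \<Rightarrow> real.
            0 < n0 \<longrightarrow> 0 < u0 \<longrightarrow> 1 \<le> n \<longrightarrow> (\<forall>i\<in>{1..n}. 0 < x i) \<longrightarrow>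
            (AE u in lborel.
               posterior_density (\<lambda>u. power_density u \<alpha>) (pareto_density (\<alpha> * n0) u0) n x u
               = pareto_density (\<alpha> * (real n + n0)) (max u0 (Max (x ` {1..n}))) u))
         \<and> conjugate_prior_family (\<lambda>u. power_density u \<alpha>) {0<..} pareto_family"
proof (intro conjI allI impI)
  fix n0 u0 :: real and n :: nat and x :: "nat \<Rightarrow> real"
  assume "0 < n0" "0 < u0" "1 \<le> n" "\<forall>i\<in>{1..n}. 0 < x i"
  thus "AE u in lborel.
      posterior_density (\<lambda>u. power_density u \<alpha>) (pareto_density (\<alpha> * n0) u0) n x u
      = pareto_density (\<alpha> * (real n + n0)) (max u0 (Max (x ` {1..n}))) u"
    using assms by (intro AE_I2 posterior_power_pareto) auto
next
  show "conjugate_prior_family (\<lambda>u. power_density u \<alpha>) {0<..} pareto_family"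
    unfolding conjugate_prior_family_def
  proof (intro ballI allI impI)
    fix p and n :: nat and x :: "nat \<Rightarrow> real"
    assume "p \<in> pareto_family" "1 \<le> n" and x: "\<forall>i\<in>{1..n}. x i \<in> {0<..}"
    then obtain a b where p: "p = pareto_density a b" "0 < a" "0 < b"
      by (auto simp: pareto_family_def)
    \<comment> \<open>As \<open>\<alpha> > 0\<close>, any shape \<open>a\<close> has the form
      \<open>\<alpha> * n0\<close> with \<open>n0 = a / \<alpha>\<close>, so the explicit posterior
      formula applies to the whole Pareto family.\<close>
    let ?q = "pareto_density (\<alpha> * (real n + a / \<alpha>)) (max b (Max (x ` {1..n})))"
    have "posterior_density (\<lambda>u. power_density u \<alpha>) p n x u = ?q u" for u
      using posterior_power_pareto[of \<alpha> "a / \<alpha>" b n x u] p x assms \<open>1 \<le> n\<close> by simp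
    moreover have "?q \<in> pareto_family"
    proof -
      have "0 < \<alpha> * (real n + a / \<alpha>)"
        using p assms by (intro mult_pos_pos add_nonneg_pos) auto
      moreover have "0 < max b (Max (x ` {1..n}))"
        using p by simp
      ultimately show ?thesis
        unfolding pareto_family_def by blast
    qed
    ultimately show "\<exists>q\<in>pareto_family.
        AE u in lborel. posterior_density (\<lambda>u. power_density u \<alpha>) p n x u = q u"
      by (intro bexI[of _ ?q]) auto
  qed
qed

end
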